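(* Let $G$ be a finite group, let $\mathcal{T}=(G,A,B)$ be a nondegenerate triple factorisation, let $\beta=B\in\Omega_B$, $k=|\beta^A|$ and $m=\mathrm{move}(\beta^A)$. Then $$|G|\leq \frac{|B|}{|A\cap B|}\left(\frac{|A|^2-m|A\cap B|^2}{|A|-m|A\cap B|}\right)$$ with equality if and only if the $G$-translates of $\beta^A$ form the blocks of a symmetric $2$-$\left(\frac{k^2-m}{k-m},k,k-m\right)$ design with point set $\Omega_B$ admitting $G$ as a flag-transitive group of automorphisms. Moreover, for every nontrivial triple factorisation $(G,A,B)$ of a finite group $G$, $$|G|\leq\frac{|A|^2|B|}{|A\cap B|^2}-\frac{|A|\cdot|B|}{|A\cap B|}+|B|,$$ with equality if and only if $G$ (acting on $\Omega_B$) is a flag-transitive collineation group of a projective plane with point set $\Omega_B$ and having the $A$-orbit containing the coset $B$ as a line.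
   Context: A triple factorisation $(G,A,B)$ consists of a finite group $G$ and subgroups $A,B\le G$ with $G=ABA$. It is trivial if $A=G$ or $B=G$, nontrivial otherwise; it is degenerate if $G=AB$ and nondegenerate if $G\neq AB$. $\Omega_B=\{Bg:g\in G\}$, on which $G$ acts by right multiplication (not necessarily faithfully); $\beta^A=\{Ba:a\in A\}$ is the $A$-orbit of the coset $B$. For a finite subset $\Gamma$ of a set $\Omega$ on which $G$ acts, the movement is $\mathrm{move}(\Gamma)=\max_{g\in G}|\Gamma^g\setminus\Gamma|$. A $2$-$(v,k,\lambda)$ design is a set of $v$ points together with a set of $k$-element subsets, called blocks, such that each pair of distinct points is contained in exactly $\lambda$ blocks; it is symmetric if it has exactly $v$ blocks. A group of automorphisms (collineations) acts on points preserving the set of blocks; it is flag-transitive if it is transitive on incident point-block pairs. A projective plane is understood as a symmetric $2$-$(k^2-k+1,k,1)$ design with $k\geq2$ (the triangle, $k=2$, being allowed), whose blocks are called lines. *)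

theory Defs
  imports Complex_Main "HOL-Algebra.Coset"
begin

definition triple_factorisation :: "('a, 'c) monoid_scheme \<Rightarrow> 'a set \<Rightarrow> 'a set \<Rightarrow> bool" where
  "triple_factorisation G A B \<longleftrightarrow>
     group G \<and> finite (carrier G) \<and> subgroup A G \<and> subgroup B G \<and>
     carrier G = A <#>\<^bsub>G\<^esub> B <#>\<^bsub>G\<^esub> A"

definition nontrivial_triple_factorisation ::
    "('a, 'c) monoid_scheme \<Rightarrow> 'a set \<Rightarrow> 'a set \<Rightarrow> bool" where
  "nontrivial_triple_factorisation G A B \<longleftrightarrow>
     triple_factorisation G A B \<and> A \<noteq> carrier G \<and> B \<noteq> carrier G"

definition nondegenerate_triple_factorisation ::
    "('a, 'c) monoid_scheme \<Rightarrow> 'a set \<Rightarrow> 'a set \<Rightarrow> bool" where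
  "nondegenerate_triple_factorisation G A B \<longleftrightarrow>
     triple_factorisation G A B \<and> carrier G \<noteq> A <#>\<^bsub>G\<^esub> B"

text \<open>An action of \<open>G\<close> is given by a map \<open>act\<close> taking a group element and a point to the image
  of that point. Right multiplication on right cosets is a right action, so it is
  not an instance of the (left) actions of the library locale \<open>group_action\<close>. The action need
  not be faithful.\<close>

definition coset_act :: "('a, 'c) monoid_scheme \<Rightarrow> 'a \<Rightarrow> 'a set \<Rightarrow> 'a set" where
  "coset_act G g C = C #>\<^bsub>G\<^esub> g"

definition orbit_of :: "('a \<Rightarrow> 'p \<Rightarrow> 'p) \<Rightarrow> 'a set \<Rightarrow> 'p \<Rightarrow> 'p set" where
  "orbit_of act H p = {act h p | h. h \<in> H}"

definition translates ::
    "('a, 'c) monoid_scheme \<Rightarrow> ('a \<Rightarrow> 'p \<Rightarrow> 'p) \<Rightarrow> 'p set \<Rightarrow> 'p set set" where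
  "translates G act \<Gamma> = {act g ` \<Gamma> | g. g \<in> carrier G}"

definition movement ::
    "('a, 'c) monoid_scheme \<Rightarrow> ('a \<Rightarrow> 'p \<Rightarrow> 'p) \<Rightarrow> 'p set \<Rightarrow> nat" where
  "movement G act \<Gamma> = Max {card (act g ` \<Gamma> - \<Gamma>) | g. g \<in> carrier G}"

definition two_design :: "'p set \<Rightarrow> 'p set set \<Rightarrow> nat \<Rightarrow> nat \<Rightarrow> nat \<Rightarrow> bool" where
  "two_design P L v k l \<longleftrightarrow>
     finite P \<and> card P = v \<and>
     (\<forall>b\<in>L. b \<subseteq> P \<and> card b = k) \<and>
     (\<forall>x\<in>P. \<forall>y\<in>P. x \<noteq> y \<longrightarrow> card {b \<in> L. x \<in> b \<and> y \<in> b} = l)"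

definition symmetric_two_design :: "'p set \<Rightarrow> 'p set set \<Rightarrow> nat \<Rightarrow> nat \<Rightarrow> nat \<Rightarrow> bool" where
  "symmetric_two_design P L v k l \<longleftrightarrow> two_design P L v k l \<and> card L = v"

definition projective_plane :: "'p set \<Rightarrow> 'p set set \<Rightarrow> bool" where
  "projective_plane P L \<longleftrightarrow> (\<exists>k\<ge>2. symmetric_two_design P L (k\<^sup>2 - k + 1) k 1)"

definition acts_as_automorphisms ::
    "('a, 'c) monoid_scheme \<Rightarrow> ('a \<Rightarrow> 'p \<Rightarrow> 'p) \<Rightarrow> 'p set \<Rightarrow> 'p set set \<Rightarrow> bool" where
  "acts_as_automorphisms G act P L \<longleftrightarrow>
     (\<forall>g\<in>carrier G. bij_betw (act g) P P \<and> (\<lambda>b. act g ` b) ` L = L)"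

definition flag_transitive ::
    "('a, 'c) monoid_scheme \<Rightarrow> ('a \<Rightarrow> 'p \<Rightarrow> 'p) \<Rightarrow> 'p set \<Rightarrow> 'p set set \<Rightarrow> bool" where
  "flag_transitive G act P L \<longleftrightarrow>
     acts_as_automorphisms G act P L \<and>
     (\<forall>p\<in>P. \<forall>b\<in>L. \<forall>q\<in>P. \<forall>c\<in>L. p \<in> b \<longrightarrow> q \<in> c \<longrightarrow>
        (\<exists>g\<in>carrier G. act g p = q \<and> act g ` b = c))"

end

theory Submission
  imports Defs
begin

text \<open>On the \<open>v = |G : B|\<close> points of the coset space, let \<open>\<Gamma> = \<beta>\<^sup>A\<close>, of size
  \<open>k = |A : A \<inter> B|\<close>. The equation \<open>G = ABA\<close> says that \<open>\<Gamma>\<close> meets all its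
  translates, and by definition of the movement any two translates share at least
  \<open>k - m\<close> points. Both bounds on \<open>|G|\<close> are therefore bounds on \<open>v\<close>, and both are the inequality
  \<open>l (v - 1) \<le> k (k - 1)\<close>, for \<open>l = k - m\<close> and for \<open>l = 1\<close>.

  This inequality needs only that the translates, as blocks of size \<open>k < v\<close>, cover each point equally
  often, say \<open>r\<close> times, and meet pairwise in at least \<open>l\<close> points. Fix a point \<open>x\<close>. For
  \<open>y \<noteq> x\<close> the numbers of blocks on \<open>x\<close> and \<open>y\<close> have a prescribed mean
  \<open>r (k - 1) / (v - 1)\<close>. Their second moment is computed from the intersections of the blocks
  through \<open>x\<close>; it falls when the intersections between blocks through \<open>x\<close> and blocks avoiding \<open>x\<close>
  grow. Since a variance is nonnegative, these intersections cannot all be large, which is the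
  inequality. Lemma \<open>defect_identity\<close> states this with the exact error
  terms. At equality the errors vanish, which makes the numbers of blocks on two points constant
  and all intersections of distinct blocks equal to \<open>l\<close>: the blocks form a symmetric design. The
  group is flag-transitive on it because \<open>G\<close> permutes the translates of \<open>\<Gamma>\<close> transitively
  and \<open>A\<close> fixes \<open>\<Gamma>\<close> while permuting its points transitively. Conversely, a design with the stated parameters has
  the extremal number of points.

  A direct count of the pairs of a translate and a point of its intersection with \<open>\<Gamma>\<close> would
  give the same bound only under \<open>r \<le> k\<close>, that is, if there are at most as many translates as
  points; the variance argument gives it in general.

  A nontrivial factorisation may be degenerate. Then \<open>\<Gamma>\<close> is the whole point set and the
  second bound is strict, as \<open>v = k \<ge> 2\<close>.\<close>

section \<open>Regular configurations with large block intersections\<close>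

text \<open>A finite tactical configuration without repeated blocks, whose blocks are proper and
  nonempty.\<close>

locale regular_configuration =
  fixes P :: "'p set" and L :: "'p set set" and k r :: nat
  assumes finite_points: "finite P"
    and blocks_subset: "\<And>b. b \<in> L \<Longrightarrow> b \<subseteq> P"
    and block_card: "\<And>b. b \<in> L \<Longrightarrow> card b = k"
    and point_degree: "\<And>x. x \<in> P \<Longrightarrow> card {b \<in> L. x \<in> b} = r"
    and blocks_nonempty: "L \<noteq> {}"
    and proper: "0 < k" "k < card P"
begin

lemma finite_blocks: "finite L"
  using finite_subset[of L "Pow P"] finite_points blocks_subset by blast

lemma finite_block: "b \<in> L \<Longrightarrow> finite b"
  using blocks_subset finite_points finite_subset by blast

lemma sum_block_inter_card:
  assumes S: "finite S" "S \<subseteq> L" and c: "c \<subseteq> P"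
  shows "(\<Sum>b\<in>S. real (card (b \<inter> c))) = (\<Sum>y\<in>c. real (card {b \<in> S. y \<in> b}))"
proof -
  have fc: "finite c" using c finite_points finite_subset by blast
  have "(\<Sum>b\<in>S. real (card (b \<inter> c))) = (\<Sum>b\<in>S. \<Sum>y\<in>c. of_bool (y \<in> b))"
    using fc by (intro sum.cong refl) (simp add: sum_of_bool_eq Int_commute Int_def)
  also have "\<dots> = (\<Sum>y\<in>c. \<Sum>b\<in>S. of_bool (y \<in> b))" by (rule sum.swap)
  also have "\<dots> = (\<Sum>y\<in>c. real (card {b \<in> S. y \<in> b}))"
    using S by (intro sum.cong refl) (simp add: sum_of_bool_eq Int_def)
  finally show ?thesis .
qed

lemma sum_inter_card_blocks:
  assumes "c \<in> L"
  shows "(\<Sum>b\<in>L. real (card (b \<inter> c))) = real r * real k"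
proof -
  have "(\<Sum>b\<in>L. real (card (b \<inter> c))) = (\<Sum>y\<in>c. real (card {b \<in> L. y \<in> b}))"
    using sum_block_inter_card[OF finite_blocks subset_refl blocks_subset[OF assms]] .
  also have "\<dots> = (\<Sum>y\<in>c. real r)"
    using blocks_subset[OF assms] point_degree by (intro sum.cong refl) auto
  finally show ?thesis using block_card[OF assms] by simp
qed

lemma flag_count: "real (card L) * real k = real (card P) * real r"
proof -
  have "(\<Sum>b\<in>L. real (card (b \<inter> P))) = (\<Sum>y\<in>P. real (card {b \<in> L. y \<in> b}))"
    using sum_block_inter_card[OF finite_blocks subset_refl subset_refl] .
  moreover have "(\<Sum>b\<in>L. real (card (b \<inter> P))) = (\<Sum>b\<in>L. real k)"
    using blocks_subset block_card by (intro sum.cong refl) (simp add: Int_absorb2)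
  moreover have "(\<Sum>y\<in>P. real (card {b \<in> L. y \<in> b})) = (\<Sum>y\<in>P. real r)"
    using point_degree by (intro sum.cong refl) simp
  ultimately show ?thesis by simp
qed

lemma degree_pos: "0 < r"
proof (rule ccontr)
  assume "\<not> 0 < r"
  then have "card L = 0" using flag_count proper by simp
  then show False using finite_blocks blocks_nonempty by simp
qed

lemma point_exists: "\<exists>x. x \<in> P"
  using proper by (metis card.empty equals0I not_less_zero)

abbreviation pair_degree :: "'p \<Rightarrow> 'p \<Rightarrow> nat" where
  "pair_degree x y \<equiv> card {b \<in> L. x \<in> b \<and> y \<in> b}"

lemma sum_pair_degree:
  assumes "x \<in> P"
  shows "(\<Sum>y\<in>P - {x}. real (pair_degree x y)) = real r * (real k - 1)"
proof -
  let ?S = "{b \<in> L. x \<in> b}"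
  have S: "finite ?S" "?S \<subseteq> L" using finite_blocks by auto
  have "(\<Sum>b\<in>?S. real (card (b \<inter> P))) = (\<Sum>y\<in>P. real (card {b \<in> ?S. y \<in> b}))"
    using sum_block_inter_card[OF S subset_refl] .
  moreover have "(\<Sum>b\<in>?S. real (card (b \<inter> P))) = (\<Sum>b\<in>?S. real k)"
    using blocks_subset block_card by (intro sum.cong refl) (simp add: Int_absorb2)
  ultimately have "(\<Sum>y\<in>P. real (pair_degree x y)) = real r * real k"
    using point_degree[OF assms] by (simp add: conj_assoc)
  then show ?thesis
    using assms finite_points point_degree[OF assms] by (simp add: sum_diff1 algebra_simps)
qed

text \<open>Both sides count the triples of a point and two blocks through it that also pass
  through \<open>x\<close>, so second moments of pair degrees are sums of block intersections.\<close>

lemma sum_pair_degree_squared: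
  assumes "x \<in> P"
  shows "(\<Sum>y\<in>P. (real (pair_degree x y))\<^sup>2) =
    (\<Sum>c\<in>{c \<in> L. x \<in> c}. \<Sum>b\<in>{b \<in> L. x \<in> b}. real (card (b \<inter> c)))"
proof -
  let ?S = "{b \<in> L. x \<in> b}"
  have S: "finite ?S" "?S \<subseteq> L" using finite_blocks by auto
  have "(\<Sum>c\<in>?S. \<Sum>b\<in>?S. real (card (b \<inter> c)))
      = (\<Sum>c\<in>?S. \<Sum>y\<in>c. real (pair_degree x y))"
    using sum_block_inter_card[OF S] blocks_subset
    by (intro sum.cong refl) (simp add: conj_assoc)
  also have "\<dots> = (\<Sum>c\<in>?S. \<Sum>y\<in>P. of_bool (y \<in> c) * real (pair_degree x y))"
  proof (rule sum.cong[OF refl])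
    fix c assume "c \<in> ?S"
    then show "(\<Sum>y\<in>c. real (pair_degree x y)) = (\<Sum>y\<in>P. of_bool (y \<in> c) * real (pair_degree x y))"
      using finite_points blocks_subset[of c] by (intro sum.mono_neutral_cong_left) auto
  qed
  also have "\<dots> = (\<Sum>y\<in>P. \<Sum>c\<in>?S. of_bool (y \<in> c) * real (pair_degree x y))"
    by (rule sum.swap)
  also have "\<dots> = (\<Sum>y\<in>P. (real (pair_degree x y))\<^sup>2)"
    using S by (intro sum.cong refl)
      (simp add: sum_distrib_right[symmetric] sum_of_bool_eq Int_def conj_assoc power2_eq_square)
  finally show ?thesis by simp
qed

text \<open>The variance of the pair degrees at \<open>x\<close>, and the total excess over \<open>l\<close> of the
  intersections of a block through \<open>x\<close> with a block avoiding \<open>x\<close>, add up to a multiple of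
  \<open>k (k - 1) - l (v - 1)\<close> which depends on the parameters only: a second moment of pair degrees
  is a sum of intersections of two blocks through \<open>x\<close>, and these sums complement those with one
  block avoiding \<open>x\<close>.\<close>

lemma defect_identity:
  fixes l :: real
  assumes x: "x \<in> P"
  defines "v \<equiv> real (card P)"
  shows "(\<Sum>y\<in>P - {x}. (real (pair_degree x y) - real r * (real k - 1) / (v - 1))\<^sup>2)
      + (\<Sum>c\<in>{c \<in> L. x \<in> c}. \<Sum>b\<in>{b \<in> L. x \<notin> b}. real (card (b \<inter> c)) - l)
    = (real r)\<^sup>2 * (v - real k) / (real k * (v - 1)) * (real k * (real k - 1) - l * (v - 1))"
proof -
  define S where "S = {b \<in> L. x \<in> b}"
  define T where "T = {b \<in> L. x \<notin> b}"
  define \<mu> where "\<mu> = real r * (real k - 1) / (v - 1)"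
  define \<kappa> where "\<kappa> = real k"
  define \<rho> where "\<rho> = real r"
  have v1: "v - 1 > 0" using proper unfolding v_def by linarith
  have kpos: "\<kappa> > 0" using proper unfolding \<kappa>_def by simp
  have fin: "finite S" "finite T" and ST: "L = S \<union> T" "S \<inter> T = {}"
    using finite_blocks unfolding S_def T_def by auto
  have cS: "real (card S) = \<rho>" unfolding S_def \<rho>_def using point_degree[OF x] by simp
  have cT: "real (card T) = \<rho> * (v - \<kappa>) / \<kappa>"
  proof -
    have "real (card L) = real (card S) + real (card T)"
      using ST fin by (simp add: card_Un_disjoint)
    moreover have "real (card L) = v * \<rho> / \<kappa>"
      using flag_count kpos unfolding v_def \<kappa>_def \<rho>_def by (simp add: field_simps)
    ultimately show ?thesis using cS kpos by (simp add: field_simps)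
  qed
  have split: "(\<Sum>b\<in>S. real (card (b \<inter> c))) = \<rho> * \<kappa> - (\<Sum>b\<in>T. real (card (b \<inter> c)))"
    if "c \<in> S" for c
    using sum_inter_card_blocks[of c] that ST fin sum.union_disjoint[of S T "\<lambda>b. real (card (b \<inter> c))"]
    unfolding \<rho>_def \<kappa>_def by auto
  define E where "E = (\<Sum>c\<in>S. \<Sum>b\<in>T. real (card (b \<inter> c)))"
  have sq: "(\<Sum>y\<in>P - {x}. (real (pair_degree x y))\<^sup>2) = \<rho>\<^sup>2 * \<kappa> - E - \<rho>\<^sup>2"
  proof -
    have "(\<Sum>y\<in>P. (real (pair_degree x y))\<^sup>2) = (\<Sum>c\<in>S. \<Sum>b\<in>S. real (card (b \<inter> c)))"
      unfolding S_def by (rule sum_pair_degree_squared[OF x])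
    also have "\<dots> = (\<Sum>c\<in>S. \<rho> * \<kappa> - (\<Sum>b\<in>T. real (card (b \<inter> c))))"
      using split by (intro sum.cong refl) simp
    also have "\<dots> = \<rho>\<^sup>2 * \<kappa> - E"
      unfolding E_def using cS by (simp add: sum_subtractf power2_eq_square)
    finally show ?thesis
      using x finite_points point_degree[OF x] unfolding \<rho>_def by (simp add: sum_diff1)
  qed
  have lin: "(\<Sum>y\<in>P - {x}. real (pair_degree x y)) = \<mu> * (v - 1)"
    using sum_pair_degree[OF x] v1 unfolding \<mu>_def by simp
  have cP: "real (card (P - {x})) = v - 1"
    using x finite_points proper unfolding v_def by (simp add: of_nat_diff)
  have "(\<Sum>y\<in>P - {x}. (real (pair_degree x y) - \<mu>)\<^sup>2)
      = (\<Sum>y\<in>P - {x}. (real (pair_degree x y))\<^sup>2 - 2 * \<mu> * real (pair_degree x y) + \<mu>\<^sup>2)"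
    by (intro sum.cong refl) (simp add: power2_diff algebra_simps)
  also have "\<dots> = (\<Sum>y\<in>P - {x}. (real (pair_degree x y))\<^sup>2)
      - 2 * \<mu> * (\<Sum>y\<in>P - {x}. real (pair_degree x y)) + real (card (P - {x})) * \<mu>\<^sup>2"
    by (simp add: sum.distrib sum_subtractf sum_distrib_left del: card_Diff_insert)
  also have "\<dots> = \<rho>\<^sup>2 * \<kappa> - E - \<rho>\<^sup>2 - (v - 1) * \<mu>\<^sup>2"
    unfolding sq lin cP by (simp add: algebra_simps power2_eq_square)
  finally have var: "(\<Sum>y\<in>P - {x}. (real (pair_degree x y) - \<mu>)\<^sup>2)
      = \<rho>\<^sup>2 * \<kappa> - E - \<rho>\<^sup>2 - (v - 1) * \<mu>\<^sup>2" .
  have exc: "(\<Sum>c\<in>S. \<Sum>b\<in>T. real (card (b \<inter> c)) - l) = E - \<rho> * (\<rho> * (v - \<kappa>) / \<kappa>) * l"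
    unfolding E_def using cS cT by (simp add: sum_subtractf)
  have mu: "(v - 1) * \<mu>\<^sup>2 = \<rho>\<^sup>2 * (\<kappa> - 1)\<^sup>2 / (v - 1)"
    unfolding \<mu>_def \<rho>_def \<kappa>_def using v1 by (simp add: power_mult_distrib power_divide power2_eq_square)
  have "\<rho>\<^sup>2 * \<kappa> - E - \<rho>\<^sup>2 - (v - 1) * \<mu>\<^sup>2 + (E - \<rho> * (\<rho> * (v - \<kappa>) / \<kappa>) * l)
      = \<rho>\<^sup>2 * (v - \<kappa>) / (\<kappa> * (v - 1)) * (\<kappa> * (\<kappa> - 1) - l * (v - 1))"
    unfolding mu using v1 kpos by (simp add: divide_simps) algebra
  then show ?thesis
    using var exc unfolding S_def T_def \<mu>_def \<rho>_def \<kappa>_def by simp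
qed

text \<open>Both summands of the defect identity are nonnegative, and its factor
  \<open>r\<^sup>2 (v - k) / (k (v - 1))\<close> is positive.\<close>

lemma intersection_bound:
  assumes inter: "\<And>b c. b \<in> L \<Longrightarrow> c \<in> L \<Longrightarrow> l \<le> card (b \<inter> c)"
  shows "real l * (real (card P) - 1) \<le> real k * (real k - 1)"
proof -
  obtain x where x: "x \<in> P" using point_exists by blast
  let ?v = "real (card P)"
  let ?f = "(real r)\<^sup>2 * (?v - real k) / (real k * (?v - 1))"
  have "0 \<le> ?f * (real k * (real k - 1) - real l * (?v - 1))"
    unfolding defect_identity[OF x, of "real l", symmetric]
    using inter by (intro add_nonneg_nonneg sum_nonneg) auto
  moreover have "0 < ?f" using degree_pos proper by (intro divide_pos_pos mult_pos_pos) auto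
  ultimately have "0 \<le> real k * (real k - 1) - real l * (?v - 1)"
    using zero_le_mult_iff by (metis less_le_not_le)
  then show ?thesis by simp
qed

text \<open>At equality both summands of the defect identity vanish at every point. Hence the pair
  degrees are constant; and any two distinct blocks meet in exactly \<open>l\<close> points, because blocks of
  equal size are separated by some point. Counting the flags whose point lies on a fixed block then forces \<open>r = k\<close>.\<close>

lemma symmetric_design_of_equality:
  assumes inter: "\<And>b c. b \<in> L \<Longrightarrow> c \<in> L \<Longrightarrow> l \<le> card (b \<inter> c)"
    and eq: "real l * (real (card P) - 1) = real k * (real k - 1)"
  shows "symmetric_two_design P L (card P) k l"
proof -
  let ?v = "real (card P)"
  let ?\<mu> = "real r * (real k - 1) / (?v - 1)"
  have v1: "?v - 1 > 0" using proper by linarith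
  have vanish: "(\<forall>y\<in>P - {x}. real (pair_degree x y) = ?\<mu>) \<and>
      (\<forall>c\<in>{c \<in> L. x \<in> c}. \<forall>b\<in>{b \<in> L. x \<notin> b}. card (b \<inter> c) = l)" if x: "x \<in> P" for x
  proof -
    let ?V = "\<Sum>y\<in>P - {x}. (real (pair_degree x y) - ?\<mu>)\<^sup>2"
    let ?X = "\<lambda>c. \<Sum>b\<in>{b \<in> L. x \<notin> b}. real (card (b \<inter> c)) - real l"
    have X: "0 \<le> ?X c" if "c \<in> L" for c using that inter by (intro sum_nonneg) auto
    have "?V + (\<Sum>c\<in>{c \<in> L. x \<in> c}. ?X c) = 0"
      unfolding defect_identity[OF x] using eq by simp
    moreover have "0 \<le> ?V" by (intro sum_nonneg) simp
    moreover have "0 \<le> (\<Sum>c\<in>{c \<in> L. x \<in> c}. ?X c)" by (rule sum_nonneg) (use X in auto)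
    ultimately have 0: "?V = 0" "(\<Sum>c\<in>{c \<in> L. x \<in> c}. ?X c) = 0" by linarith+
    have "\<forall>y\<in>P - {x}. real (pair_degree x y) = ?\<mu>"
      using 0(1) finite_points by (subst (asm) sum_nonneg_eq_0_iff) auto
    moreover have "\<forall>c\<in>{c \<in> L. x \<in> c}. ?X c = 0"
      using 0(2) X finite_blocks by (subst (asm) sum_nonneg_eq_0_iff) auto
    moreover have "card (b \<inter> c) = l"
      if "?X c = 0" "c \<in> L" "b \<in> L" "x \<notin> b" for b c
    proof -
      have "\<forall>b\<in>{b \<in> L. x \<notin> b}. real (card (b \<inter> c)) - real l = 0"
        using that inter finite_blocks by (subst (asm) sum_nonneg_eq_0_iff) auto
      then show ?thesis using that by auto
    qed
    ultimately show ?thesis by blast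
  qed
  have meet: "card (b \<inter> c) = l" if "b \<in> L" "c \<in> L" "b \<noteq> c" for b c
  proof -
    have "\<not> c \<subseteq> b" using that card_subset_eq[of b c] finite_block block_card by metis
    then obtain x where "x \<in> c" "x \<notin> b" by blast
    then show ?thesis using vanish[of x] that blocks_subset[of c] by blast
  qed
  obtain b where b: "b \<in> L" using blocks_nonempty by blast
  have "real r * real k = real k + (\<Sum>c\<in>L - {b}. real (card (c \<inter> b)))"
    using sum_inter_card_blocks[OF b] sum.remove[OF finite_blocks b, of "\<lambda>c. real (card (c \<inter> b))"]
      block_card[OF b] by simp
  also have "(\<Sum>c\<in>L - {b}. real (card (c \<inter> b))) = (\<Sum>c\<in>L - {b}. real l)"
    using meet b by (intro sum.cong refl) auto
  also have "\<dots> = (real (card L) - 1) * real l"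
    using finite_blocks b blocks_nonempty
    by (simp add: of_nat_diff Suc_leI card_gt_0_iff)
  finally have rk: "real r * real k = real k + (real (card L) - 1) * real l" .
  have lk: "real l \<noteq> real k"
  proof
    assume "real l = real k"
    then have "?v - 1 = real k - 1" using eq proper by simp
    then show False using proper by simp
  qed
  have "(real r - real k) * (real k - real l) = 0"
  proof -
    have "real k * (real r * real k) = real k * real k + (?v * real r - real k) * real l"
      unfolding rk using flag_count by algebra
    then show ?thesis using eq by algebra
  qed
  then have r: "real r = real k" using lk by simp
  then have cL: "card L = card P" using flag_count proper by simp
  have "?\<mu> = real l" using eq r v1 by (simp add: field_simps)
  then have "pair_degree x y = l" if "x \<in> P" "y \<in> P" "x \<noteq> y" for x y
    using vanish[OF that(1)] that by auto
  then show ?thesis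
    unfolding symmetric_two_design_def two_design_def
    using finite_points blocks_subset block_card cL by auto
qed

end

section \<open>Translates of an orbit in a coset space\<close>

locale coset_orbit = group G for G (structure) +
  fixes A B :: "'a set"
  assumes finite_carrier: "finite (carrier G)"
    and A: "subgroup A G" and B: "subgroup B G"
begin

abbreviation points :: "'a set set" where "points \<equiv> rcosets B"
abbreviation orbit :: "'a set set" where "orbit \<equiv> orbit_of (coset_act G) A B"
abbreviation blocks :: "'a set set set" where "blocks \<equiv> translates G (coset_act G) orbit"

lemma A_subset: "A \<subseteq> carrier G"
  using A subgroup.subset by blast

lemma A_carrier: "a \<in> A \<Longrightarrow> a \<in> carrier G"
  using A_subset by blast

lemma B_subset: "B \<subseteq> carrier G"
  using B subgroup.subset by blast

lemma pointE:
  assumes "C \<in> points"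
  obtains g where "g \<in> carrier G" "C = B #> g"
  using assms unfolding RCOSETS_def by blast

lemma act_coset: "g \<in> carrier G \<Longrightarrow> h \<in> carrier G \<Longrightarrow> coset_act G h (B #> g) = B #> (g \<otimes> h)"
  unfolding coset_act_def using coset_mult_assoc B_subset by simp

lemma act_closed: "C \<in> points \<Longrightarrow> h \<in> carrier G \<Longrightarrow> coset_act G h C \<in> points"
  by (elim pointE) (simp add: act_coset rcosetsI B_subset)

lemma act_act:
  "C \<in> points \<Longrightarrow> g \<in> carrier G \<Longrightarrow> h \<in> carrier G \<Longrightarrow>
    coset_act G h (coset_act G g C) = coset_act G (g \<otimes> h) C"
  by (elim pointE) (simp add: act_coset m_assoc)

lemma act_one: "C \<in> points \<Longrightarrow> coset_act G \<one> C = C"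
  by (elim pointE) (simp add: act_coset)

lemma image_act_act:
  assumes "S \<subseteq> points" "g \<in> carrier G" "h \<in> carrier G"
  shows "coset_act G h ` coset_act G g ` S = coset_act G (g \<otimes> h) ` S"
  unfolding image_image using assms act_act by (intro image_cong refl) auto

lemma image_act_one: "S \<subseteq> points \<Longrightarrow> coset_act G \<one> ` S = S"
  using act_one by (force simp: subset_iff)

lemma act_inj_on: "g \<in> carrier G \<Longrightarrow> inj_on (coset_act G g) points"
  by (rule inj_on_inverseI[of _ "coset_act G (inv g)"]) (simp add: act_act act_one)

lemma act_bij: "g \<in> carrier G \<Longrightarrow> bij_betw (coset_act G g) points points"
  by (rule bij_betw_byWitness[where f' = "coset_act G (inv g)"])
    (auto simp: act_act act_one act_closed)

lemma act_transitive:
  assumes "C \<in> points" "D \<in> points"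
  obtains g where "g \<in> carrier G" "coset_act G g C = D"
proof -
  obtain x y where xy: "x \<in> carrier G" "C = B #> x" "y \<in> carrier G" "D = B #> y"
    using assms by (meson pointE)
  have "x \<otimes> (inv x \<otimes> y) = y" using xy by (simp add: m_assoc[symmetric])
  then have "coset_act G (inv x \<otimes> y) C = D" using xy by (simp add: act_coset)
  then show thesis using xy by (intro that[of "inv x \<otimes> y"]) auto
qed

lemma orbit_eq: "orbit = (\<lambda>a. B #> a) ` A"
  unfolding orbit_of_def coset_act_def by blast

lemma orbit_subset: "orbit \<subseteq> points"
  unfolding orbit_eq using A_carrier rcosetsI B_subset by blast

lemma finite_points: "finite points"
  using finite_carrier unfolding RCOSETS_def by simp

lemma finite_orbit: "finite orbit"
  using orbit_subset finite_points finite_subset by blast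

lemma card_points: "card points * card B = order G"
  using lagrange[OF B] .

lemma card_B_pos: "0 < card B"
  using finite_subset[OF B_subset finite_carrier] subgroup.one_closed[OF B] card_gt_0_iff by blast

lemma card_inter_pos: "0 < card (A \<inter> B)"
  using finite_subset[OF B_subset finite_carrier] subgroup.one_closed[OF A] subgroup.one_closed[OF B]
  by (auto simp: card_gt_0_iff)

lemma act_orbit:
  assumes "a \<in> A"
  shows "coset_act G a ` orbit = orbit"
proof -
  have sub: "coset_act G x ` orbit \<subseteq> orbit" if x: "x \<in> A" for x
  proof
    fix C assume "C \<in> coset_act G x ` orbit"
    then obtain y where "y \<in> A" "C = coset_act G x (B #> y)" unfolding orbit_eq by blast
    then show "C \<in> orbit"
      unfolding orbit_eq using x A_carrier act_coset subgroup.m_closed[OF A] by auto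
  qed
  have "orbit = coset_act G a ` coset_act G (inv a) ` orbit"
    using assms A_carrier by (simp add: image_act_act image_act_one orbit_subset)
  also have "\<dots> \<subseteq> coset_act G a ` orbit"
    using sub[of "inv a"] assms subgroup.m_inv_closed[OF A] by (intro image_mono) blast
  finally show ?thesis using sub[OF assms] by blast
qed

text \<open>Orbit--stabiliser: the fibres of \<open>a \<mapsto> B a\<close> on \<open>A\<close> are the right cosets of
  \<open>A \<inter> B\<close>.\<close>

lemma card_orbit: "card orbit * card (A \<inter> B) = card A"
proof -
  have finA: "finite A" using finite_subset[OF A_subset finite_carrier] .
  have AB: "A \<inter> B \<subseteq> carrier G" using B_subset by blast
  have fibre: "card {a \<in> A. B #> a = C} = card (A \<inter> B)" if C: "C \<in> orbit" for C
  proof -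
    obtain c where c: "c \<in> A" "C = B #> c" using C unfolding orbit_eq by blast
    have "{a \<in> A. B #> a = C} = (A \<inter> B) #> c"
    proof
      show "{a \<in> A. B #> a = C} \<subseteq> (A \<inter> B) #> c"
      proof
        fix a assume "a \<in> {a \<in> A. B #> a = C}"
        then have a: "a \<in> A" "B #> a = B #> c" using c by auto
        have "a \<in> B #> c" using a A_carrier B rcos_self by metis
        then obtain b where b: "b \<in> B" "a = b \<otimes> c" unfolding r_coset_def by blast
        have "b = a \<otimes> inv c"
          using b c B_subset A_carrier[OF c(1)] by (simp add: m_assoc subset_iff)
        then have "b \<in> A"
          using a c subgroup.m_closed[OF A] subgroup.m_inv_closed[OF A] by simp
        then show "a \<in> (A \<inter> B) #> c" using b unfolding r_coset_def by blast
      qed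
      show "(A \<inter> B) #> c \<subseteq> {a \<in> A. B #> a = C}"
      proof
        fix a assume "a \<in> (A \<inter> B) #> c"
        then obtain b where b: "b \<in> A" "b \<in> B" "a = b \<otimes> c" unfolding r_coset_def by blast
        have "B #> a = (B #> b) #> c"
          using b c A_carrier B_subset coset_mult_assoc by simp
        then show "a \<in> {a \<in> A. B #> a = C}"
          using b c coset_join2[OF A_carrier B] subgroup.m_closed[OF A] by simp
      qed
    qed
    then show ?thesis
      using card_rcosets_equal[OF rcosetsI[OF AB A_carrier[OF c(1)]] AB] by simp
  qed
  have "card A = (\<Sum>C\<in>orbit. card {a \<in> A. B #> a = C})"
  proof -
    have "card A = card (\<Union>C\<in>orbit. {a \<in> A. B #> a = C})"
      unfolding orbit_eq by (rule arg_cong[of _ _ card]) auto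
    also have "\<dots> = (\<Sum>C\<in>orbit. card {a \<in> A. B #> a = C})"
      using finA finite_orbit by (intro card_UN_disjoint) auto
    finally show ?thesis .
  qed
  then show ?thesis using fibre by simp
qed

lemma orbit_pos: "0 < card orbit"
  using finite_orbit subgroup.one_closed[OF A] unfolding orbit_eq card_gt_0_iff by blast

lemma orbit_in_blocks: "orbit \<in> blocks"
proof -
  have "orbit = coset_act G \<one> ` orbit" using image_act_one[OF orbit_subset] by simp
  then show ?thesis unfolding translates_def using one_closed by blast
qed

lemma blockE:
  assumes "b \<in> blocks"
  obtains g where "g \<in> carrier G" "b = coset_act G g ` orbit"
  using assms unfolding translates_def by blast

lemma block_subset: "b \<in> blocks \<Longrightarrow> b \<subseteq> points"
  using act_closed orbit_subset by (elim blockE) blast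

lemma card_block: "b \<in> blocks \<Longrightarrow> card b = card orbit"
  by (elim blockE) (simp, meson act_inj_on card_image inj_on_subset orbit_subset)

lemma act_block:
  assumes "b \<in> blocks" "g \<in> carrier G"
  shows "coset_act G g ` b \<in> blocks"
proof -
  obtain h where h: "h \<in> carrier G" "b = coset_act G h ` orbit" using assms(1) by (rule blockE)
  then have "coset_act G g ` b = coset_act G (h \<otimes> g) ` orbit"
    using assms(2) by (simp add: image_act_act orbit_subset)
  then show ?thesis unfolding translates_def using h assms(2) by blast
qed

lemma automorphisms: "acts_as_automorphisms G (coset_act G) points blocks"
  unfolding acts_as_automorphisms_def
proof (intro ballI conjI act_bij)
  fix g assume g: "g \<in> carrier G"
  show "(\<lambda>b. coset_act G g ` b) ` blocks = blocks"
  proof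
    show "(\<lambda>b. coset_act G g ` b) ` blocks \<subseteq> blocks" using act_block g by blast
    show "blocks \<subseteq> (\<lambda>b. coset_act G g ` b) ` blocks"
    proof
      fix b assume b: "b \<in> blocks"
      have "b = coset_act G g ` coset_act G (inv g) ` b"
        using g block_subset[OF b] by (simp add: image_act_act image_act_one)
      then show "b \<in> (\<lambda>b. coset_act G g ` b) ` blocks" using act_block[OF b, of "inv g"] g by blast
    qed
  qed
qed

text \<open>\<open>G\<close> permutes the translates transitively by construction, and \<open>A\<close> fixes \<open>\<beta>\<^sup>A\<close> while
  permuting its points transitively. So the flag \<open>(\<beta>, \<beta>\<^sup>A)\<close> can be moved to any other.\<close>

lemma flag_from_base:
  assumes b: "b \<in> blocks" and p: "p \<in> b"
  obtains g where "g \<in> carrier G" "coset_act G g B = p" "coset_act G g ` orbit = b"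
proof -
  obtain h where h: "h \<in> carrier G" "b = coset_act G h ` orbit" using b by (rule blockE)
  then obtain a where a: "a \<in> A" "p = coset_act G h (B #> a)"
    using p unfolding orbit_eq by blast
  have ac: "a \<in> carrier G" using a A_carrier by blast
  have "coset_act G (a \<otimes> h) ` orbit = coset_act G h ` coset_act G a ` orbit"
    using image_act_act[OF orbit_subset] ac h by simp
  also have "\<dots> = b" using act_orbit[OF a(1)] h by simp
  finally have "coset_act G (a \<otimes> h) ` orbit = b" .
  moreover have "coset_act G (a \<otimes> h) B = p"
    using a ac h act_coset unfolding coset_act_def by simp
  ultimately show thesis using that ac h by blast
qed

lemma base_point: "B \<in> points"
  using rcosetsI[OF B_subset one_closed] coset_mult_one[OF B_subset] by simp

lemma flag_transitive_blocks: "flag_transitive G (coset_act G) points blocks"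
  unfolding flag_transitive_def
proof (intro conjI ballI impI automorphisms)
  fix p b q c
  assume "b \<in> blocks" "c \<in> blocks" "p \<in> b" "q \<in> c"
  then obtain g h where g: "g \<in> carrier G" "coset_act G g B = p" "coset_act G g ` orbit = b"
    and h: "h \<in> carrier G" "coset_act G h B = q" "coset_act G h ` orbit = c"
    using flag_from_base by metis
  have "coset_act G (inv g \<otimes> h) p = q"
    using g h base_point act_act[of p "inv g" h] act_act[OF base_point, of g "inv g"] act_closed
    by (auto simp: act_one)
  moreover have "coset_act G (inv g \<otimes> h) ` b = c"
  proof -
    have "coset_act G (inv g \<otimes> h) ` coset_act G g ` orbit = coset_act G (g \<otimes> (inv g \<otimes> h)) ` orbit"
      using g h by (intro image_act_act orbit_subset) auto
    also have "g \<otimes> (inv g \<otimes> h) = h" using g h by (simp add: m_assoc[symmetric])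
    finally show ?thesis using g h by simp
  qed
  ultimately show "\<exists>x\<in>carrier G. coset_act G x p = q \<and> coset_act G x ` b = c"
    using g h by blast
qed

lemma finite_blocks: "finite blocks"
  using finite_subset[of blocks "Pow points"] block_subset finite_points by blast

lemma degree_le:
  assumes x: "x \<in> points" and y: "y \<in> points"
  shows "card {b \<in> blocks. x \<in> b} \<le> card {b \<in> blocks. y \<in> b}"
proof -
  obtain g where g: "g \<in> carrier G" "coset_act G g x = y" using x y by (rule act_transitive)
  show ?thesis
  proof (rule card_inj_on_le)
    show "inj_on ((`) (coset_act G g)) {b \<in> blocks. x \<in> b}"
      using inj_on_image_eq_iff[OF act_inj_on[OF g(1)]] block_subset
      by (intro inj_onI) blast
    show "(`) (coset_act G g) ` {b \<in> blocks. x \<in> b} \<subseteq> {b \<in> blocks. y \<in> b}"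
      using act_block g by auto
    show "finite {b \<in> blocks. y \<in> b}" using finite_blocks by simp
  qed
qed

lemma blocks_configuration:
  assumes "orbit \<noteq> points"
  shows "regular_configuration points blocks (card orbit) (card {b \<in> blocks. B \<in> b})"
proof
  show "card orbit < card points"
    using assms orbit_subset finite_points psubset_card_mono by (metis psubsetI)
  show "card {b \<in> blocks. x \<in> b} = card {b \<in> blocks. B \<in> b}" if "x \<in> points" for x
    using degree_le[OF that base_point] degree_le[OF base_point that] by (rule le_antisym)
  show "blocks \<noteq> {}" using orbit_in_blocks by blast
qed (fact finite_points block_subset card_block orbit_pos)+

text \<open>Translating back by the inverse of \<open>h\<close> reduces intersections of two translates to
  intersections with \<open>\<beta>\<^sup>A\<close> itself.\<close>

lemma inter_blocks_ge:
  assumes l: "\<And>g. g \<in> carrier G \<Longrightarrow> l \<le> card (coset_act G g ` orbit \<inter> orbit)"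
    and b: "b \<in> blocks" and c: "c \<in> blocks"
  shows "l \<le> card (b \<inter> c)"
proof -
  obtain g h where g: "g \<in> carrier G" "b = coset_act G g ` orbit"
    and h: "h \<in> carrier G" "c = coset_act G h ` orbit" using b c by (metis blockE)
  let ?d = "coset_act G (g \<otimes> inv h) ` orbit"
  have d: "?d \<subseteq> points" using g h act_closed orbit_subset by blast
  have "b = coset_act G h ` ?d"
    using g h by (simp add: image_act_act orbit_subset m_assoc)
  then have "b \<inter> c = coset_act G h ` (?d \<inter> orbit)"
    using h inj_on_image_Int[OF act_inj_on[OF h(1)] d orbit_subset] by simp
  moreover have "card (coset_act G h ` (?d \<inter> orbit)) = card (?d \<inter> orbit)"
    by (rule card_image, rule inj_on_subset[OF act_inj_on[OF h(1)]]) (use d in blast)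
  ultimately show ?thesis using l[of "g \<otimes> inv h"] g h by simp
qed

text \<open>For \<open>a\<^sub>1, a\<^sub>2 \<in> A\<close> the set \<open>a\<^sub>1 B a\<^sub>2\<close> contains \<open>g\<close> if and only if \<open>g\<close> maps the point
  \<open>B a\<^sub>1\<inverse>\<close> of \<open>\<beta>\<^sup>A\<close> to \<open>B a\<^sub>2\<close>, so \<open>G = ABA\<close> means exactly that \<open>\<beta>\<^sup>A\<close> meets all its translates.\<close>

lemma factorisation_inter_pos:
  assumes "carrier G = A <#> B <#> A" and g: "g \<in> carrier G"
  shows "0 < card (coset_act G g ` orbit \<inter> orbit)"
proof -
  obtain a b c where abc: "a \<in> A" "b \<in> B" "c \<in> A" "g = a \<otimes> b \<otimes> c"
    using assms unfolding set_mult_def by blast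
  have car: "a \<in> carrier G" "b \<in> carrier G" "c \<in> carrier G"
    using abc A_carrier B_subset by auto
  have "inv a \<otimes> g = b \<otimes> c"
    using abc car by (simp add: m_assoc) (simp add: m_assoc[symmetric])
  then have "coset_act G g (B #> inv a) = B #> c"
    using car g coset_join2[OF car(2) B abc(2)] by (simp add: act_coset coset_mult_assoc[OF B_subset, symmetric])
  moreover have "B #> inv a \<in> orbit" "B #> c \<in> orbit"
    unfolding orbit_eq using abc subgroup.m_inv_closed[OF A] by auto
  ultimately have "B #> c \<in> coset_act G g ` orbit \<inter> orbit" by (metis IntI imageI)
  then show ?thesis using finite_orbit card_gt_0_iff by blast
qed

text \<open>Taking inverses turns \<open>G = BA\<close>, which says that \<open>A\<close> is transitive on the coset space,
  into \<open>G = AB\<close>.\<close>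

lemma nondegenerate_orbit:
  assumes "carrier G \<noteq> A <#> B"
  shows "orbit \<noteq> points"
proof
  assume eq: "orbit = points"
  have "g \<in> A <#> B" if g: "g \<in> carrier G" for g
  proof -
    have "B #> inv g \<in> orbit" using eq g rcosetsI[OF B_subset] by simp
    then obtain a where a: "a \<in> A" "B #> inv g = B #> a" unfolding orbit_eq by blast
    then have "inv g \<in> B #> a" using g rcos_self[OF _ B, of "inv g"] by simp
    then obtain b where b: "b \<in> B" "inv g = b \<otimes> a" unfolding r_coset_def by blast
    have "g = inv (b \<otimes> a)" using b(2) g by (metis inv_inv)
    also have "\<dots> = inv a \<otimes> inv b" using a b A_carrier B_subset by (simp add: inv_mult_group subset_iff)
    finally show ?thesis
      unfolding set_mult_def
      using a b subgroup.m_inv_closed[OF A] subgroup.m_inv_closed[OF B] by blast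
  qed
  moreover have "A <#> B \<subseteq> carrier G"
    using set_mult_closed subgroup.subset A B by blast
  ultimately show False using assms by blast
qed

lemma finite_displacements: "finite {card (coset_act G g ` orbit - orbit) | g. g \<in> carrier G}"
  using finite_carrier by simp

lemma displaced_add_inter:
  assumes "g \<in> carrier G"
  shows "card (coset_act G g ` orbit - orbit) + card (coset_act G g ` orbit \<inter> orbit) = card orbit"
proof -
  have "coset_act G g ` orbit \<in> blocks" using assms unfolding translates_def by blast
  then have "card (coset_act G g ` orbit) = card orbit" by (rule card_block)
  moreover have "finite (coset_act G g ` orbit)" using finite_orbit by simp
  ultimately show ?thesis
    by (metis Diff_Diff_Int Diff_subset Int_lower1 add.commute card_Diff_subset card_Int_Diff)
qed

lemma inter_ge_movement:
  assumes "g \<in> carrier G"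
  shows "card orbit - movement G (coset_act G) orbit \<le> card (coset_act G g ` orbit \<inter> orbit)"
proof -
  have "card (coset_act G g ` orbit - orbit) \<le> movement G (coset_act G) orbit"
    unfolding movement_def using assms finite_displacements by (intro Max_ge) auto
  then show ?thesis using displaced_add_inter[OF assms] by linarith
qed

lemma movement_less:
  assumes "carrier G = A <#> B <#> A"
  shows "movement G (coset_act G) orbit < card orbit"
proof -
  have "{card (coset_act G g ` orbit - orbit) | g. g \<in> carrier G} \<noteq> {}"
    using one_closed by blast
  then have "movement G (coset_act G) orbit \<in> {card (coset_act G g ` orbit - orbit) | g. g \<in> carrier G}"
    unfolding movement_def using finite_displacements by (rule Max_in[rotated])
  then obtain g where "g \<in> carrier G"
    "movement G (coset_act G) orbit = card (coset_act G g ` orbit - orbit)" by blast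
  then show ?thesis
    using displaced_add_inter[of g] factorisation_inter_pos[OF assms, of g] by linarith
qed

lemma real_card_A: "real (card A) = real (card orbit) * real (card (A \<inter> B))"
  using card_orbit by (metis of_nat_mult)

lemma real_order: "real (order G) = real (card points) * real (card B)"
  using card_points by (metis of_nat_mult)

proposition nondegenerate_case:
  assumes fact: "carrier G = A <#> B <#> A" and nondeg: "carrier G \<noteq> A <#> B"
  defines "k \<equiv> card orbit" and "m \<equiv> movement G (coset_act G) orbit"
  defines "bound \<equiv> real (card B) / real (card (A \<inter> B)) *
      (((real (card A))\<^sup>2 - real m * (real (card (A \<inter> B)))\<^sup>2) /
       (real (card A) - real m * real (card (A \<inter> B))))"
  shows "real (order G) \<le> bound \<and>
    (real (order G) = bound \<longleftrightarrow>
      (\<exists>v l :: nat. real v = ((real k)\<^sup>2 - real m) / (real k - real m) \<and>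
        real l = real k - real m \<and>
        symmetric_two_design points blocks v k l \<and>
        flag_transitive G (coset_act G) points blocks))"
proof -
  interpret C: regular_configuration points blocks k "card {b \<in> blocks. B \<in> b}"
    unfolding k_def by (rule blocks_configuration[OF nondegenerate_orbit[OF nondeg]])
  let ?v = "real (card points)"
  have mk: "m < k" using movement_less[OF fact] unfolding m_def k_def .
  have inter: "k - m \<le> card (b \<inter> c)" if "b \<in> blocks" "c \<in> blocks" for b c
    using inter_blocks_ge[OF inter_ge_movement that] unfolding k_def m_def .
  have pos: "real k - real m > 0" and l: "real (k - m) = real k - real m" using mk by auto
  have a: "real (card (A \<inter> B)) > 0" and bB: "real (card B) > 0"
    using card_inter_pos card_B_pos by simp_all
  let ?q = "((real k)\<^sup>2 - real m) / (real k - real m)"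
  have bound: "bound = ?q * real (card B)"
  proof -
    have "(real (card A))\<^sup>2 - real m * (real (card (A \<inter> B)))\<^sup>2
        = (real (card (A \<inter> B)))\<^sup>2 * ((real k)\<^sup>2 - real m)"
      unfolding real_card_A k_def by (simp add: algebra_simps power2_eq_square)
    moreover have "real (card A) - real m * real (card (A \<inter> B))
        = real (card (A \<inter> B)) * (real k - real m)"
      unfolding real_card_A k_def by (simp add: algebra_simps)
    ultimately show ?thesis
      unfolding bound_def using a by (simp add: power2_eq_square)
  qed
  \<comment> \<open>Dividing by \<open>l = k - m\<close> turns \<open>l (v - 1) \<le> k (k - 1)\<close> into \<open>v \<le> (k\<^sup>2 - m) / (k - m)\<close>.\<close>
  have le: "real (k - m) * (?v - 1) \<le> real k * (real k - 1)"
    using C.intersection_bound[OF inter] .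
  have q_le: "?v \<le> ?q"
    using le pos unfolding l by (simp add: pos_le_divide_eq algebra_simps power2_eq_square)
  have q_eq: "real (k - m) * (?v - 1) = real k * (real k - 1)" if "?v = ?q"
    using that pos unfolding l by (simp add: eq_divide_eq algebra_simps power2_eq_square)
  have ob: "real (order G) = bound \<longleftrightarrow> ?v = ?q"
    unfolding bound real_order mult_cancel_right using bB by simp
  show ?thesis
  proof (intro conjI)
    show "real (order G) \<le> bound"
      unfolding bound real_order using q_le bB by (intro mult_right_mono) auto
    show "real (order G) = bound \<longleftrightarrow>
      (\<exists>v l :: nat. real v = ?q \<and> real l = real k - real m \<and>
        symmetric_two_design points blocks v k l \<and>
        flag_transitive G (coset_act G) points blocks)"
    proof
      assume "real (order G) = bound"
      then have "?v = ?q" using ob by simp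
      then show "\<exists>v l :: nat. real v = ?q \<and> real l = real k - real m \<and>
          symmetric_two_design points blocks v k l \<and>
          flag_transitive G (coset_act G) points blocks"
        using C.symmetric_design_of_equality[OF inter q_eq] l flag_transitive_blocks by blast
    next
      assume "\<exists>v l :: nat. real v = ?q \<and> real l = real k - real m \<and>
          symmetric_two_design points blocks v k l \<and>
          flag_transitive G (coset_act G) points blocks"
      then have "?v = ?q" unfolding symmetric_two_design_def two_design_def by auto
      then show "real (order G) = bound" using ob by simp
    qed
  qed
qed

proposition nontrivial_case:
  assumes fact: "carrier G = A <#> B <#> A" and nontriv: "B \<noteq> carrier G"
  defines "bound \<equiv> (real (card A))\<^sup>2 * real (card B) / (real (card (A \<inter> B)))\<^sup>2
      - real (card A) * real (card B) / real (card (A \<inter> B)) + real (card B)"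
  shows "real (order G) \<le> bound \<and>
    (real (order G) = bound \<longleftrightarrow>
      (\<exists>L. projective_plane points L \<and> orbit \<in> L \<and> flag_transitive G (coset_act G) points L))"
proof -
  define k where "k = card orbit"
  let ?v = "real (card points)"
  let ?q = "(real k)\<^sup>2 - real k + 1"
  have a: "real (card (A \<inter> B)) > 0" and bB: "real (card B) > 0"
    using card_inter_pos card_B_pos by simp_all
  have k: "k > 0" using orbit_pos unfolding k_def .
  have kv: "k \<le> card points" unfolding k_def using orbit_subset finite_points card_mono by blast
  have "card points \<noteq> 1"
  proof
    assume "card points = 1"
    then have "card B = card (carrier G)" using card_points unfolding order_def by simp
    then show False using nontriv B_subset finite_carrier card_subset_eq by blast
  qed
  then have v2: "card points \<ge> 2" using k kv by linarith
  have bound: "bound = ?q * real (card B)"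
    unfolding bound_def real_card_A k_def using a by (simp add: field_simps power2_eq_square)
  have ob: "real (order G) = bound \<longleftrightarrow> ?v = ?q"
    unfolding bound real_order mult_cancel_right using bB by simp
  have inter: "1 \<le> card (b \<inter> c)" if "b \<in> blocks" "c \<in> blocks" for b c
    by (rule inter_blocks_ge[OF _ that]) (use factorisation_inter_pos[OF fact] in \<open>simp add: Suc_leI\<close>)
  \<comment> \<open>If \<open>\<beta>\<^sup>A\<close> is everything, then \<open>v = k \<ge> 2\<close>, and \<open>k < k\<^sup>2 - k + 1\<close> holds strictly.\<close>
  have deg: "?v < ?q" if "orbit = points"
  proof -
    have "?v = real k" "real k \<ge> 2" using that v2 unfolding k_def by simp_all
    moreover have "0 < (real k - 1)\<^sup>2" using \<open>real k \<ge> 2\<close> by simp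
    ultimately show ?thesis by (simp add: power2_eq_square algebra_simps)
  qed
  have nondeg: "1 * (?v - 1) \<le> real k * (real k - 1) \<and>
      (1 * (?v - 1) = real k * (real k - 1) \<longrightarrow>
        symmetric_two_design points blocks (card points) k 1)" if "orbit \<noteq> points"
  proof -
    interpret C: regular_configuration points blocks k "card {b \<in> blocks. B \<in> b}"
      unfolding k_def by (rule blocks_configuration[OF that])
    show ?thesis
      using C.intersection_bound[of 1] C.symmetric_design_of_equality[of 1] inter by simp
  qed
  have q_le: "?v \<le> ?q"
    using deg nondeg by (cases "orbit = points") (auto simp: algebra_simps power2_eq_square)
  show ?thesis
  proof (intro conjI)
    show "real (order G) \<le> bound"
      unfolding bound real_order using q_le bB by (intro mult_right_mono) auto
    show "real (order G) = bound \<longleftrightarrow>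
      (\<exists>L. projective_plane points L \<and> orbit \<in> L \<and> flag_transitive G (coset_act G) points L)"
    proof
      assume "real (order G) = bound"
      then have vq: "?v = ?q" using ob by simp
      then have "orbit \<noteq> points" using deg by auto
      then have sym: "symmetric_two_design points blocks (card points) k 1"
        using nondeg vq by (simp add: algebra_simps power2_eq_square)
      have "k \<noteq> 1" using vq v2 by auto
      then have "k \<ge> 2" using k by linarith
      moreover have "card points = k\<^sup>2 - k + 1"
      proof -
        have "k \<le> k\<^sup>2" by (simp add: power2_eq_square)
        then have "real (k\<^sup>2 - k + 1) = ?v" using vq by (simp add: of_nat_diff)
        then show ?thesis by linarith
      qed
      ultimately have "projective_plane points blocks"
        unfolding projective_plane_def using sym by auto
      then show "\<exists>L. projective_plane points L \<and> orbit \<in> L \<and> flag_transitive G (coset_act G) points L"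
        using orbit_in_blocks flag_transitive_blocks by blast
    next
      assume "\<exists>L. projective_plane points L \<and> orbit \<in> L \<and> flag_transitive G (coset_act G) points L"
      then have "card points = k\<^sup>2 - k + 1"
        unfolding projective_plane_def symmetric_two_design_def two_design_def k_def by auto
      moreover have "k \<le> k\<^sup>2" by (simp add: power2_eq_square)
      ultimately have "?v = ?q" by (simp add: of_nat_diff)
      then show "real (order G) = bound" using ob by simp
    qed
  qed
qed

end

lemma coset_orbit_of_factorisation:
  "triple_factorisation G A B \<Longrightarrow> coset_orbit G A B"
  unfolding triple_factorisation_def coset_orbit_def coset_orbit_axioms_def by blast

section \<open>The order of a group with a triple factorisation\<close>

theorem theorem3p4:
  fixes G :: "('a, 'c) monoid_scheme" and A B :: "'a set"
  shows
    "(nondegenerate_triple_factorisation G A B \<longrightarrow>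
       (let \<Omega> = rcosets\<^bsub>G\<^esub> B;
            \<Gamma> = orbit_of (coset_act G) A B;
            k = card \<Gamma>;
            m = movement G (coset_act G) \<Gamma>;
            bound = real (card B) / real (card (A \<inter> B)) *
              (((real (card A))\<^sup>2 - real m * (real (card (A \<inter> B)))\<^sup>2) /
               (real (card A) - real m * real (card (A \<inter> B))))
        in real (order G) \<le> bound \<and>
           (real (order G) = bound \<longleftrightarrow>
             (\<exists>v l :: nat.
                real v = ((real k)\<^sup>2 - real m) / (real k - real m) \<and>
                real l = real k - real m \<and>
                symmetric_two_design \<Omega> (translates G (coset_act G) \<Gamma>) v k l \<and>
                flag_transitive G (coset_act G) \<Omega> (translates G (coset_act G) \<Gamma>)))))
     \<and>
     (nontrivial_triple_factorisation G A B \<longrightarrow>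
       (let \<Omega> = rcosets\<^bsub>G\<^esub> B;
            \<Gamma> = orbit_of (coset_act G) A B;
            bound = (real (card A))\<^sup>2 * real (card B) / (real (card (A \<inter> B)))\<^sup>2
              - real (card A) * real (card B) / real (card (A \<inter> B)) + real (card B)
        in real (order G) \<le> bound \<and>
           (real (order G) = bound \<longleftrightarrow>
             (\<exists>L. projective_plane \<Omega> L \<and> \<Gamma> \<in> L \<and>
                  flag_transitive G (coset_act G) \<Omega> L))))"
proof (intro conjI impI)
  assume "nondegenerate_triple_factorisation G A B"
  then have T: "triple_factorisation G A B" and nondeg: "carrier G \<noteq> A <#>\<^bsub>G\<^esub> B"
    unfolding nondegenerate_triple_factorisation_def by auto
  then have fact: "carrier G = A <#>\<^bsub>G\<^esub> B <#>\<^bsub>G\<^esub> A" unfolding triple_factorisation_def by simp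
  show "let \<Omega> = rcosets\<^bsub>G\<^esub> B;
            \<Gamma> = orbit_of (coset_act G) A B;
            k = card \<Gamma>;
            m = movement G (coset_act G) \<Gamma>;
            bound = real (card B) / real (card (A \<inter> B)) *
              (((real (card A))\<^sup>2 - real m * (real (card (A \<inter> B)))\<^sup>2) /
               (real (card A) - real m * real (card (A \<inter> B))))
        in real (order G) \<le> bound \<and>
           (real (order G) = bound \<longleftrightarrow>
             (\<exists>v l :: nat.
                real v = ((real k)\<^sup>2 - real m) / (real k - real m) \<and>
                real l = real k - real m \<and>
                symmetric_two_design \<Omega> (translates G (coset_act G) \<Gamma>) v k l \<and>
                flag_transitive G (coset_act G) \<Omega> (translates G (coset_act G) \<Gamma>)))"
    unfolding Let_def
    by (rule coset_orbit.nondegenerate_case[OF coset_orbit_of_factorisation[OF T] fact nondeg])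
next
  assume "nontrivial_triple_factorisation G A B"
  then have T: "triple_factorisation G A B" and nontriv: "B \<noteq> carrier G"
    unfolding nontrivial_triple_factorisation_def by auto
  then have fact: "carrier G = A <#>\<^bsub>G\<^esub> B <#>\<^bsub>G\<^esub> A" unfolding triple_factorisation_def by simp
  show "let \<Omega> = rcosets\<^bsub>G\<^esub> B;
            \<Gamma> = orbit_of (coset_act G) A B;
            bound = (real (card A))\<^sup>2 * real (card B) / (real (card (A \<inter> B)))\<^sup>2
              - real (card A) * real (card B) / real (card (A \<inter> B)) + real (card B)
        in real (order G) \<le> bound \<and>
           (real (order G) = bound \<longleftrightarrow>
             (\<exists>L. projective_plane \<Omega> L \<and> \<Gamma> \<in> L \<and>
                  flag_transitive G (coset_act G) \<Omega> L))"
    unfolding Let_def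
    by (rule coset_orbit.nontrivial_case[OF coset_orbit_of_factorisation[OF T] fact nontriv])
qed

end
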